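(* Up to isomorphism, there are only finitely many finite simple groups which do not admit a Cayley representation.
   Context: For a group $G$ and a non-empty subset $S\subseteq G$, the Cayley poset $P(G,S)$ has as underlying set the disjoint union of two copies $G$ and $G'=\{g' : g\in G\}$ of $G$; for $g,h\in G$ one sets $g<h'$ if and only if $h\in gS$, and no other pair of different points is comparable. Left multiplication on each copy of $G$ gives an action $L:G\to \mathrm{Aut}(P(G,S))$, where $\mathrm{Aut}$ denotes the group of poset automorphisms. If every automorphism of $P(G,S)$ is in the image of $L$, then $P(G,S)$ is called a Cayley representation of $G$. The group $G$ admits a Cayley representation if there is a non-empty $S\subseteq G$ such that $P(G,S)$ is a Cayley representation of $G$. Finite simple groups include the abelian ones (cyclic groups of prime order). *)

theory Defs
  imports "HOL-Algebra.Bij" "HOL-Algebra.Order" "HOL-Algebra.SimpleGroups"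
begin

text \<open>\<^term>\<open>Inl g\<close> is the element \<open>g\<close> of the first copy of the group,
  \<^term>\<open>Inr g\<close> the element \<open>g'\<close> of the second. The order is the reflexive one.\<close>

definition cayley_poset :: "('a, 'm) monoid_scheme \<Rightarrow> 'a set \<Rightarrow> ('a + 'a) gorder" where
  "cayley_poset G S =
    \<lparr>carrier = carrier G <+> carrier G,
     eq = (=),
     le = (\<lambda>x y. x = y \<or> (\<exists>g h. x = Inl g \<and> y = Inr h \<and> h \<in> g <#\<^bsub>G\<^esub> S))\<rparr>"

text \<open>As in \<^const>\<open>Bij\<close>, automorphisms are extensional, so that they are determined by
  their values on the carrier.\<close>

definition poset_auto :: "('a, 'm) gorder_scheme \<Rightarrow> ('a \<Rightarrow> 'a) set" where
  "poset_auto P = {f \<in> Bij (carrier P).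
     \<forall>x \<in> carrier P. \<forall>y \<in> carrier P. f x \<sqsubseteq>\<^bsub>P\<^esub> f y \<longleftrightarrow> x \<sqsubseteq>\<^bsub>P\<^esub> y}"

definition PosetAutoGroup :: "('a, 'm) gorder_scheme \<Rightarrow> ('a \<Rightarrow> 'a) monoid" where
  "PosetAutoGroup P = BijGroup (carrier P) \<lparr>carrier := poset_auto P\<rparr>"

definition left_action :: "('a, 'm) monoid_scheme \<Rightarrow> 'a \<Rightarrow> 'a + 'a \<Rightarrow> 'a + 'a" where
  "left_action G g =
    (\<lambda>x \<in> carrier G <+> carrier G. map_sum (\<lambda>h. g \<otimes>\<^bsub>G\<^esub> h) (\<lambda>h. g \<otimes>\<^bsub>G\<^esub> h) x)"

definition cayley_representation :: "('a, 'm) monoid_scheme \<Rightarrow> 'a set \<Rightarrow> bool" where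
  "cayley_representation G S \<longleftrightarrow>
    carrier (PosetAutoGroup (cayley_poset G S)) \<subseteq> left_action G ` carrier G"

definition admits_cayley_representation :: "('a, 'm) monoid_scheme \<Rightarrow> bool" where
  "admits_cayley_representation G \<longleftrightarrow>
    (\<exists>S. S \<noteq> {} \<and> S \<subseteq> carrier G \<and> cayley_representation G S)"

lemma partial_order_cayley_poset: "partial_order (cayley_poset G S)"
  by unfold_locales (auto simp: cayley_poset_def)

lemma lless_cayley_poset_iff:
  "x \<sqsubset>\<^bsub>cayley_poset G S\<^esub> y \<longleftrightarrow> (\<exists>g h. x = Inl g \<and> y = Inr h \<and> h \<in> g <#\<^bsub>G\<^esub> S)"
  by (auto simp: lless_def cayley_poset_def)

lemma subgroup_poset_auto: "subgroup (poset_auto P) (BijGroup (carrier P))"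
proof (rule subgroup.intro)
  show "poset_auto P \<subseteq> carrier (BijGroup (carrier P))"
    by (auto simp: poset_auto_def BijGroup_def)
next
  fix f g assume "f \<in> poset_auto P" "g \<in> poset_auto P"
  moreover from this have "g x \<in> carrier P" if "x \<in> carrier P" for x
    using that Bij_imp_funcset by (fastforce simp: poset_auto_def)
  ultimately show "f \<otimes>\<^bsub>BijGroup (carrier P)\<^esub> g \<in> poset_auto P"
    by (auto simp: poset_auto_def BijGroup_def compose_Bij compose_eq)
next
  show "\<one>\<^bsub>BijGroup (carrier P)\<^esub> \<in> poset_auto P"
    by (auto simp: poset_auto_def BijGroup_def id_Bij)
next
  fix f assume f: "f \<in> poset_auto P"
  then have B: "f \<in> Bij (carrier P)" by (simp add: poset_auto_def)
  have "f (inv_into (carrier P) f x) = x" if "x \<in> carrier P" for x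
    using B that by (auto simp: Bij_def bij_betw_def f_inv_into_f)
  moreover have "f u \<sqsubseteq>\<^bsub>P\<^esub> f v \<longleftrightarrow> u \<sqsubseteq>\<^bsub>P\<^esub> v" if "u \<in> carrier P" "v \<in> carrier P" for u v
    using f that by (simp add: poset_auto_def)
  ultimately have "inv_into (carrier P) f x \<sqsubseteq>\<^bsub>P\<^esub> inv_into (carrier P) f y \<longleftrightarrow> x \<sqsubseteq>\<^bsub>P\<^esub> y"
    if "x \<in> carrier P" "y \<in> carrier P" for x y
    using that Bij_inv_into_mem[OF B] by metis
  then show "inv\<^bsub>BijGroup (carrier P)\<^esub> f \<in> poset_auto P"
    using B by (simp add: poset_auto_def inv_BijGroup restrict_inv_into_Bij)
qed

lemma group_PosetAutoGroup: "group (PosetAutoGroup P)"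
  unfolding PosetAutoGroup_def
  by (rule subgroup.subgroup_is_group[OF subgroup_poset_auto group_BijGroup])

lemma (in group) left_action_in_poset_auto:
  assumes g: "g \<in> carrier G" and S: "S \<subseteq> carrier G"
  shows "left_action G g \<in> poset_auto (cayley_poset G S)"
proof -
  have "bij_betw (left_action G g) (carrier G <+> carrier G) (carrier G <+> carrier G)"
    by (rule bij_betw_byWitness[where f' = "left_action G (inv g)"])
      (use g in \<open>auto simp: left_action_def m_assoc[symmetric]\<close>)
  moreover have "g \<otimes> y \<in> (g \<otimes> x) <# S \<longleftrightarrow> y \<in> x <# S"
    if "x \<in> carrier G" "y \<in> carrier G" for x y
  proof -
    have "g \<otimes> y = g \<otimes> x \<otimes> s \<longleftrightarrow> y = x \<otimes> s" if "s \<in> S" for s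
      using g S \<open>x \<in> carrier G\<close> \<open>y \<in> carrier G\<close> that by (subst m_assoc) auto
    then show ?thesis by (auto simp: l_coset_def)
  qed
  ultimately show ?thesis
    using g by (auto simp: poset_auto_def cayley_poset_def Bij_def left_action_def)
qed

lemma (in group) left_action_hom:
  assumes S: "S \<subseteq> carrier G"
  shows "left_action G \<in> hom G (PosetAutoGroup (cayley_poset G S))"
proof (rule homI)
  fix g h assume gh: "g \<in> carrier G" "h \<in> carrier G"
  then have "left_action G g \<in> Bij (carrier G <+> carrier G)"
    "left_action G h \<in> Bij (carrier G <+> carrier G)"
    using left_action_in_poset_auto[OF _ S] by (auto simp: poset_auto_def cayley_poset_def)
  moreover have "left_action G (g \<otimes> h) =
      compose (carrier G <+> carrier G) (left_action G g) (left_action G h)"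
    using gh by (auto simp: left_action_def compose_def fun_eq_iff m_assoc)
  ultimately show "left_action G (g \<otimes> h) =
      left_action G g \<otimes>\<^bsub>PosetAutoGroup (cayley_poset G S)\<^esub> left_action G h"
    by (simp add: PosetAutoGroup_def BijGroup_def cayley_poset_def)
qed (use left_action_in_poset_auto[OF _ S] in \<open>auto simp: PosetAutoGroup_def\<close>)

end

theory Submission
  imports Defs "HOL-Algebra.Generated_Groups" "HOL-Real_Asymp.Real_Asymp"
begin

text \<open>In fact every sufficiently large finite group admits a Cayley representation. Choose
  generic elements \<open>f\<^sub>0, \<dots>, f\<^sub>q\<close> with \<open>q\<close> about \<open>log |G|\<close>; since the subgroup generated so far
  at least doubles with each generic choice, the quotients \<open>f\<^sub>i f\<^sub>j\<^sup>-\<^sup>1\<close> with \<open>i, j \<ge> 2\<close> generate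
  \<open>G\<close>. Let \<open>S\<close> be the union of the blocks \<open>{f\<^sub>0, \<dots>, f\<^sub>m} a\<^sub>k\<close>, \<open>m = min k q\<close>, for generic
  \<open>a\<^sub>0, \<dots>, a\<^bsub>L-1\<^esub>\<close>. Automorphisms preserve the number \<open>|gS \<inter> hS|\<close> of common upper bounds of \<open>g\<close>
  and \<open>h\<close>, which depends on \<open>x = g\<^sup>-\<^sup>1 h\<close> only. If \<open>x = f\<^sub>i f\<^sub>j\<^sup>-\<^sup>1\<close>, this number is \<open>L - max i j\<close>
  or twice that, and it is smaller for all other \<open>x \<noteq> 1\<close>, so it determines \<open>max i j\<close>.
  Hence the lower bounds of a point that come from one block are mapped to lower bounds that
  come from one block, with the positions \<open>j \<ge> 2\<close> in the block kept, and an automorphism fixing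
  \<open>g\<close> fixes all \<open>g f\<^sub>i f\<^sub>j\<^sup>-\<^sup>1\<close> with \<open>i, j \<ge> 2\<close>. So an automorphism fixing \<open>1\<close> is trivial on the
  first copy of \<open>G\<close>, and it is trivial on the second copy because \<open>S\<close> has no right stabilizer.\<close>

section \<open>Quotients in a group\<close>

definition (in group) quo :: "'a \<Rightarrow> 'a \<Rightarrow> 'a" where
  "quo x y = x \<otimes> inv y"

context group
begin

lemma mult_inv_cancel [simp]: "x \<in> carrier G \<Longrightarrow> y \<in> carrier G \<Longrightarrow> x \<otimes> (inv x \<otimes> y) = y"
  by (simp add: m_assoc[symmetric])

lemma inv_mult_cancel [simp]: "x \<in> carrier G \<Longrightarrow> y \<in> carrier G \<Longrightarrow> inv x \<otimes> (x \<otimes> y) = y"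
  by (simp add: m_assoc[symmetric])

lemma quo_closed [simp, intro]: "x \<in> carrier G \<Longrightarrow> y \<in> carrier G \<Longrightarrow> quo x y \<in> carrier G"
  by (simp add: quo_def)

lemma inv_quo: "x \<in> carrier G \<Longrightarrow> y \<in> carrier G \<Longrightarrow> inv (quo x y) = quo y x"
  by (simp add: quo_def inv_mult_group)

lemma quo_eq_one_iff:
  "x \<in> carrier G \<Longrightarrow> y \<in> carrier G \<Longrightarrow> quo x y = \<one> \<longleftrightarrow> x = y"
  by (simp add: quo_def inv_solve_right')

lemma quo_self [simp]: "x \<in> carrier G \<Longrightarrow> quo x x = \<one>"
  by (simp add: quo_eq_one_iff)

text \<open>The factor \<open>a\<close> cancels. This is why the blocks, being right translates of
  initial segments of one sequence \<open>f\<close>, share their quotients.\<close>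

lemma quo_mult_right:
  assumes "x \<in> carrier G" "y \<in> carrier G" "a \<in> carrier G"
  shows "quo (x \<otimes> a) (y \<otimes> a) = quo x y"
  using assms by (simp add: quo_def inv_mult_group m_assoc)

lemma quo_left_cancel:
  assumes "x \<in> carrier G" "y \<in> carrier G" "z \<in> carrier G"
  shows "quo x y = quo x z \<longleftrightarrow> y = z"
  using assms by (simp add: quo_def) (metis inv_inv)

lemma quo_right_cancel:
  assumes "x \<in> carrier G" "y \<in> carrier G" "z \<in> carrier G"
  shows "quo x z = quo y z \<longleftrightarrow> x = y"
  using assms by (simp add: quo_def)

lemma quo_swap:
  assumes "x \<in> carrier G" "y \<in> carrier G" "z \<in> carrier G" "w \<in> carrier G"
    and "quo x y = quo z w"
  shows "quo y x = quo w z"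
  using assms by (metis inv_quo)

lemma inv_quo_mult:
  assumes "x \<in> carrier G" "y \<in> carrier G"
  shows "inv (quo x y) \<otimes> x = y"
  using assms by (simp add: quo_def inv_mult_group m_assoc)

lemma quo_inv_mult:
  assumes "x \<in> carrier G" "s \<in> carrier G"
  shows "quo s (inv x \<otimes> s) = x"
  using assms by (simp add: quo_def inv_mult_group m_assoc[symmetric])

end

section \<open>Blocks and the levels of quotients\<close>

text \<open>If \<open>\<sigma> j\<close> differs from \<open>j\<close>, the maxima with 0 and with 1
  force \<open>\<sigma> 0 = j\<close> and \<open>\<sigma> 1 = j\<close>. Swapping 0 and 1 preserves
  all maxima, so these two positions have to be left out, here and in the generating set.\<close>

lemma max_preserving_fixes:
  fixes \<sigma> :: "nat \<Rightarrow> nat"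
  assumes max: "\<And>i j. i \<le> q \<Longrightarrow> j \<le> q \<Longrightarrow> i \<noteq> j \<Longrightarrow> max (\<sigma> i) (\<sigma> j) = max i j"
    and neq: "\<And>i j. i \<le> q \<Longrightarrow> j \<le> q \<Longrightarrow> i \<noteq> j \<Longrightarrow> \<sigma> i \<noteq> \<sigma> j"
    and "2 \<le> j" "j \<le> q"
  shows "\<sigma> j = j"
proof (rule ccontr)
  assume "\<sigma> j \<noteq> j"
  then have "\<sigma> 0 = j" "\<sigma> 1 = j"
    using max[of 0 j] max[of 1 j] assms(3,4) by (auto simp: max_def split: if_splits)
  then show False using neq[of 0 1] assms(3,4) by simp
qed

text \<open>The choice of \<open>L\<close> makes the numbers \<open>L - j\<close>, \<open>2 (L - j)\<close> for \<open>j \<le> q\<close> distinct and larger than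
  the bound \<open>2 (q + 1)\<close> of \<open>codegree_other\<close> below. A factor 2 is unavoidable because
  \<open>f\<^sub>i f\<^sub>j\<^sup>-\<^sup>1\<close> may be an involution.\<close>

locale block_system = group G for G :: "('a, 'm) monoid_scheme" (structure) +
  fixes f a :: "nat \<Rightarrow> 'a" and q L :: nat
  assumes finite_carrier: "finite (carrier G)"
    and f_closed: "i \<le> q \<Longrightarrow> f i \<in> carrier G"
    and a_closed: "k < L \<Longrightarrow> a k \<in> carrier G"
    and f_generic: "\<lbrakk>j \<le> q; i < j; k < j; l < j\<rbrakk> \<Longrightarrow> quo (f j) (f i) \<noteq> quo (f k) (f l)"
    and a_generic: "\<lbrakk>k < L; l < k; m < k; n < k; i \<le> q; j \<le> q; i' \<le> q; j' \<le> q\<rbrakk>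
      \<Longrightarrow> quo (f i \<otimes> a k) (f j \<otimes> a l) \<noteq> quo (f i' \<otimes> a m) (f j' \<otimes> a n)"
    and q_ge_2: "2 \<le> q"
    and L_eq: "L = 4 * q + 4"
begin

definition p :: "nat \<Rightarrow> nat \<Rightarrow> 'a" where
  "p i k = f i \<otimes> a k"

text \<open>Block \<open>k\<close> stops at position \<open>min k q\<close>. Hence two positions
  with maximum \<open>J\<close> occur together exactly in the blocks from \<open>J\<close> to
  \<open>L - 1\<close>, and the number of these blocks reveals \<open>J\<close>.\<close>

definition S :: "'a set" where
  "S = {p i k |i k. i \<le> q \<and> i \<le> k \<and> k < L}"

text \<open>The size of the intersection of \<open>S\<close> and \<open>x <# S\<close>, that is, the
  number of ways to write \<open>x\<close> as \<open>quo s t\<close> with \<open>s\<close> and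
  \<open>t\<close> in \<open>S\<close>.\<close>

definition codegree :: "'a \<Rightarrow> nat" where
  "codegree x = card {s \<in> S. inv x \<otimes> s \<in> S}"

lemma p_closed [simp, intro]: "i \<le> q \<Longrightarrow> k < L \<Longrightarrow> p i k \<in> carrier G"
  by (simp add: p_def f_closed a_closed)

lemma S_subset: "S \<subseteq> carrier G"
  by (auto simp: S_def)

lemma p_in_S: "i \<le> q \<Longrightarrow> i \<le> k \<Longrightarrow> k < L \<Longrightarrow> p i k \<in> S"
  by (auto simp: S_def)

lemma quo_p_same: "i \<le> q \<Longrightarrow> j \<le> q \<Longrightarrow> k < L \<Longrightarrow> quo (p i k) (p j k) = quo (f i) (f j)"
  by (simp add: p_def quo_mult_right f_closed a_closed)

lemma f_inj: "i \<le> q \<Longrightarrow> j \<le> q \<Longrightarrow> f i = f j \<Longrightarrow> i = j"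
proof (induction i j rule: linorder_wlog)
  case (le i j)
  then show ?case using f_generic[of j i i i] by (cases "i = j") auto
qed auto

text \<open>An index on the left exceeding all the others contradicts \<open>f_generic\<close>. As
  \<open>f_generic\<close> has the largest index in the first argument of \<open>quo\<close>, the
  equation is inverted if that index is \<open>j\<close>. By symmetry \<open>max i j\<close> is an
  invariant of a nontrivial quotient, its level.\<close>

lemma level_le:
  assumes ne: "i \<noteq> j" and bounds: "i \<le> q" "j \<le> q" "k \<le> q" "l \<le> q"
    and eq: "quo (f i) (f j) = quo (f k) (f l)"
  shows "max i j \<le> max k l"
proof (rule ccontr)
  assume "\<not> max i j \<le> max k l"
  then consider "j < i" "k < i" "l < i" | "i < j" "k < j" "l < j"
    using ne by (auto simp: max_def split: if_splits)
  then show False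
  proof cases
    case 1
    then show False using f_generic[OF bounds(1) 1] eq by simp
  next
    case 2
    have "quo (f j) (f i) = quo (f l) (f k)"
      by (rule quo_swap[OF _ _ _ _ eq]) (use bounds f_closed in auto)
    then show False
      using f_generic[OF bounds(2) 2(1,3,2)] by simp
  qed
qed

lemma level_unique:
  assumes "i \<le> q" "j \<le> q" "k \<le> q" "l \<le> q" "i \<noteq> j" "k \<noteq> l" "quo (f i) (f j) = quo (f k) (f l)"
  shows "max i j = max k l"
  using level_le[of i j k l] level_le[of k l i j] assms by (intro antisym) auto

text \<open>The argument of \<open>level_le\<close> with block indices instead of positions;
  \<open>a_generic\<close> allows arbitrary positions inside the blocks.\<close>

lemma block_level_le:
  assumes ne: "k \<noteq> l" and bounds: "k < L" "l < L" "m < L" "n < L" "i \<le> q" "j \<le> q" "i' \<le> q" "j' \<le> q"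
    and eq: "quo (p i k) (p j l) = quo (p i' m) (p j' n)"
  shows "max k l \<le> max m n"
proof (rule ccontr)
  assume "\<not> max k l \<le> max m n"
  then consider "l < k" "m < k" "n < k" | "k < l" "m < l" "n < l"
    using ne by (auto simp: max_def split: if_splits)
  then show False
  proof cases
    case 1
    then show False using a_generic[OF bounds(1) 1 bounds(5-8)] eq by (simp add: p_def)
  next
    case 2
    have "quo (p j l) (p i k) = quo (p j' n) (p i' m)"
      by (rule quo_swap[OF _ _ _ _ eq]) (use bounds in auto)
    then show False
      using a_generic[OF bounds(2) 2(1,3,2) bounds(6,5,8,7)] by (simp add: p_def)
  qed
qed

text \<open>The quotient on the right also occurs inside block \<open>min k l\<close>. If
  \<open>k\<close> and \<open>l\<close> differed, \<open>block_level_le\<close> would bound their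
  maximum by their minimum.\<close>

lemma same_block:
  assumes "k < L" "l < L" "i \<le> q" "j \<le> q" "i' \<le> q" "j' \<le> q"
    and "quo (p i k) (p j l) = quo (f i') (f j')"
  shows "k = l"
proof (rule ccontr)
  assume "k \<noteq> l"
  moreover have "quo (p i k) (p j l) = quo (p i' (min k l)) (p j' (min k l))"
    using assms by (simp add: quo_p_same)
  ultimately have "max k l \<le> max (min k l) (min k l)"
    using assms by (intro block_level_le) auto
  with \<open>k \<noteq> l\<close> show False by linarith
qed

lemma p_inj:
  assumes "k < L" "l < L" "i \<le> q" "j \<le> q" "p i k = p j l"
  shows "i = j \<and> k = l"
proof -
  have "quo (p i k) (p j l) = quo (f 0) (f 0)"
    using assms f_closed[of 0] by simp
  then have "k = l" using assms same_block[of k l i j 0 0] by simp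
  with assms have "f i = f j" by (simp add: p_def f_closed a_closed)
  with \<open>k = l\<close> show ?thesis using f_inj assms by blast
qed

section \<open>Codegrees of quotients\<close>

text \<open>By \<open>same_block\<close>, each representation of \<open>x\<close> as a quotient in
  \<open>S\<close> consists of a pair of positions in \<open>P\<close> and one block. All pairs in
  \<open>P\<close> have level \<open>J\<close>, so each occurs in \<open>L - J\<close> blocks. One
  entry of each pair is \<open>J\<close>, and either entry determines the other, so \<open>P\<close>
  has at most two elements.\<close>

lemma codegree_level:
  assumes "i \<le> q" "j \<le> q" "i \<noteq> j"
  shows "codegree (quo (f i) (f j)) \<in> {L - max i j, 2 * (L - max i j)}"
proof -
  define J where "J = max i j"
  define x where "x = quo (f i) (f j)"
  define P where "P = {(k, l). k \<le> q \<and> l \<le> q \<and> quo (f k) (f l) = x}"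
  have x: "x \<in> carrier G" using assms f_closed by (simp add: x_def)
  have x1: "x \<noteq> \<one>" using assms f_closed f_inj by (auto simp: x_def quo_eq_one_iff)
  have P: "k \<le> q" "l \<le> q" "quo (f k) (f l) = x" "k \<noteq> l" "max k l = J" if "(k, l) \<in> P" for k l
  proof -
    show *: "k \<le> q" "l \<le> q" "quo (f k) (f l) = x" using that by (auto simp: P_def)
    show "k \<noteq> l" using * x1 f_closed by auto
    then show "max k l = J" using level_unique[of k l i j] * assms by (simp add: x_def J_def)
  qed
  have "finite P" by (rule finite_subset[of _ "{..q} \<times> {..q}"]) (auto simp: P_def)
  have fst_eq: "z = w" if "z \<in> P" "w \<in> P" "fst z = fst w" for z w
    using that P(1-3) f_closed f_inj by (cases z; cases w) (metis fst_conv quo_left_cancel)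
  have snd_eq: "z = w" if "z \<in> P" "w \<in> P" "snd z = snd w" for z w
    using that P(1-3) f_closed f_inj by (cases z; cases w) (metis snd_conv quo_right_cancel)
  have "P \<subseteq> {z \<in> P. fst z = J} \<union> {z \<in> P. snd z = J}"
    using P(5) by (force simp: max_def split: if_splits)
  then have "card P \<le> card ({z \<in> P. fst z = J} \<union> {z \<in> P. snd z = J})"
    using \<open>finite P\<close> by (intro card_mono) auto
  also have "\<dots> \<le> card {z \<in> P. fst z = J} + card {z \<in> P. snd z = J}"
    by (rule card_Un_le)
  also have "\<dots> \<le> 1 + 1"
    using \<open>finite P\<close> fst_eq snd_eq by (intro add_mono) (auto simp: card_le_Suc0_iff_eq)
  finally have "card P \<le> 2" by simp
  moreover have "(i, j) \<in> P" using assms by (simp add: P_def x_def)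
  then have "card P \<noteq> 0" using \<open>finite P\<close> by auto
  ultimately have "card P = 1 \<or> card P = 2" by linarith
  moreover have "bij_betw (\<lambda>((k, l), b). p k b) (P \<times> {J..<L}) {s \<in> S. inv x \<otimes> s \<in> S}"
  proof (rule bij_betw_imageI)
    show "inj_on (\<lambda>((k, l), b). p k b) (P \<times> {J..<L})"
    proof (rule inj_onI, clarsimp)
      fix k l b k' l' b'
      assume *: "(k, l) \<in> P" "(k', l') \<in> P" "b < L" "b' < L" "p k b = p k' b'"
      then have "k = k' \<and> b = b'" using p_inj P(1) by blast
      then show "k = k' \<and> l = l' \<and> b = b'" using * fst_eq by fastforce
    qed
  next
    show "(\<lambda>((k, l), b). p k b) ` (P \<times> {J..<L}) = {s \<in> S. inv x \<otimes> s \<in> S}"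
    proof (intro equalityI subsetI)
      fix s assume "s \<in> (\<lambda>((k, l), b). p k b) ` (P \<times> {J..<L})"
      then obtain k l b where *: "(k, l) \<in> P" "J \<le> b" "b < L" "s = p k b" by auto
      have "quo (p k b) (p l b) = x" using * P by (simp add: quo_p_same)
      then have "inv x \<otimes> s = p l b" using * P inv_quo_mult[of "p k b" "p l b"] by simp
      moreover have "k \<le> b" "l \<le> b" using P(5)[OF *(1)] *(2) by auto
      ultimately show "s \<in> {s \<in> S. inv x \<otimes> s \<in> S}"
        using * P[OF *(1)] by (simp add: p_in_S)
    next
      fix s assume "s \<in> {s \<in> S. inv x \<otimes> s \<in> S}"
      then obtain k b l b' where *: "s = p k b" "k \<le> q" "k \<le> b" "b < L"
        "inv x \<otimes> s = p l b'" "l \<le> q" "l \<le> b'" "b' < L" unfolding S_def by blast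
      then have "quo (p k b) (p l b') = x" using x quo_inv_mult[of x s] by simp
      moreover from this have "b = b'" using same_block * assms x_def by blast
      ultimately have kl: "(k, l) \<in> P" using * by (simp add: P_def quo_p_same)
      then have "J \<le> b" using P(5)[OF kl] * \<open>b = b'\<close> by auto
      then show "s \<in> (\<lambda>((k, l), b). p k b) ` (P \<times> {J..<L})"
        using * kl by force
    qed
  qed
  then have "codegree x = card P * (L - J)"
    by (simp add: codegree_def bij_betw_same_card[symmetric] card_cartesian_product)
  ultimately show ?thesis by (auto simp: x_def J_def)
qed

text \<open>Every representation of \<open>x\<close> now uses two different blocks, and by
  \<open>block_level_le\<close> the larger block index is always the same \<open>K\<close>. So
  \<open>s\<close> or \<open>inv x \<otimes> s\<close> is one of the at most \<open>q + 1\<close>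
  elements of block \<open>K\<close>.\<close>

lemma codegree_other:
  assumes x: "x \<in> carrier G" and "\<And>i j. i \<le> q \<Longrightarrow> j \<le> q \<Longrightarrow> x \<noteq> quo (f i) (f j)"
  shows "codegree x \<le> 2 * (q + 1)"
proof (cases "{s \<in> S. inv x \<otimes> s \<in> S} = {}")
  case False
  have rep: "\<exists>k b l b'. s = p k b \<and> inv x \<otimes> s = p l b' \<and> k \<le> q \<and> l \<le> q \<and> b < L \<and> b' < L \<and> b \<noteq> b'
      \<and> quo (p k b) (p l b') = x" if "s \<in> {s \<in> S. inv x \<otimes> s \<in> S}" for s
  proof -
    from that obtain k b l b' where *: "s = p k b" "k \<le> q" "k \<le> b" "b < L"
      "inv x \<otimes> s = p l b'" "l \<le> q" "l \<le> b'" "b' < L" unfolding S_def by blast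
    moreover from this have "quo (p k b) (p l b') = x" using x quo_inv_mult[of x s] by simp
    moreover from this have "b \<noteq> b'" using * assms(2) quo_p_same by metis
    ultimately show ?thesis by blast
  qed
  from False obtain s0 where "s0 \<in> {s \<in> S. inv x \<otimes> s \<in> S}" by blast
  from rep[OF this] obtain k0 b0 l0 b0' where 0: "k0 \<le> q" "l0 \<le> q" "b0 < L" "b0' < L" "b0 \<noteq> b0'"
    "quo (p k0 b0) (p l0 b0') = x" by blast
  define K where "K = max b0 b0'"
  have "{s \<in> S. inv x \<otimes> s \<in> S} \<subseteq> (\<lambda>k. p k K) ` {..q} \<union> (\<lambda>l. x \<otimes> p l K) ` {..q}"
  proof
    fix s assume s: "s \<in> {s \<in> S. inv x \<otimes> s \<in> S}"
    from rep[OF s] obtain k b l b' where *: "s = p k b" "inv x \<otimes> s = p l b'" "k \<le> q" "l \<le> q"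
      "b < L" "b' < L" "b \<noteq> b'" "quo (p k b) (p l b') = x" by blast
    have "max b b' = K"
      using block_level_le[of b b' b0 b0' k l k0 l0] block_level_le[of b0 b0' b b' k0 l0 k l] * 0
      unfolding K_def by (intro antisym) auto
    moreover have "s = x \<otimes> p l b'"
      using *(2) x s S_subset mult_inv_cancel[of x s] by auto
    ultimately have "s = p k K \<or> s = x \<otimes> p l K" using *(1) by (metis max_def)
    then show "s \<in> (\<lambda>k. p k K) ` {..q} \<union> (\<lambda>l. x \<otimes> p l K) ` {..q}"
      using *(3,4) by blast
  qed
  then have "codegree x \<le> card ((\<lambda>k. p k K) ` {..q} \<union> (\<lambda>l. x \<otimes> p l K) ` {..q})"
    unfolding codegree_def by (intro card_mono) auto
  also have "\<dots> \<le> card ((\<lambda>k. p k K) ` {..q}) + card ((\<lambda>l. x \<otimes> p l K) ` {..q})"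
    by (rule card_Un_le)
  also have "\<dots> \<le> card {..q} + card {..q}" by (intro add_mono card_image_le) auto
  finally show ?thesis by simp
qed (simp only: codegree_def card.empty le0)

text \<open>Levels range from 1 to \<open>q\<close>. So \<open>L - J\<close> lies between
  \<open>3 * q + 4\<close> and \<open>4 * q + 3\<close>, which is beyond the reach of
  \<open>codegree_other\<close>, and its double is at least \<open>6 * q + 8\<close>. Hence neither
  value can be confused with one for another level.\<close>

lemma codegree_determines_level:
  assumes ij: "i \<le> q" "j \<le> q" "i \<noteq> j" and y: "y \<in> carrier G" "y \<noteq> \<one>"
    and eq: "codegree y = codegree (quo (f i) (f j))"
  shows "\<exists>i' j'. i' \<le> q \<and> j' \<le> q \<and> i' \<noteq> j' \<and> y = quo (f i') (f j') \<and> max i' j' = max i j"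
proof -
  have "codegree (quo (f i) (f j)) > 2 * (q + 1)"
    using codegree_level[OF ij] ij by (auto simp: L_eq max_def)
  then obtain i' j' where *: "i' \<le> q" "j' \<le> q" "y = quo (f i') (f j')"
    using codegree_other[OF y(1)] eq by (metis leD)
  moreover have "i' \<noteq> j'" using * y f_closed by auto
  moreover have "max i' j' = max i j"
    using codegree_level[OF ij] codegree_level[of i' j'] * ij \<open>i' \<noteq> j'\<close> eq
    by (auto simp: L_eq max_def split: if_splits)
  ultimately show ?thesis by blast
qed

section \<open>Recognition of blocks and the right stabilizer of \<open>S\<close>\<close>

text \<open>Any two \<open>s i\<close>, \<open>s j\<close> lie in a common block by
  \<open>same_block\<close>. By \<open>level_unique\<close> their positions have maximum
  \<open>max i j\<close>, so \<open>max_preserving_fixes\<close> applies to the map of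
  positions.\<close>

lemma block_recognition:
  assumes s: "\<And>i. i \<le> q \<Longrightarrow> s i \<in> S"
    and level: "\<And>i j. i \<le> q \<Longrightarrow> j \<le> q \<Longrightarrow> i \<noteq> j \<Longrightarrow>
      \<exists>i' j'. i' \<le> q \<and> j' \<le> q \<and> i' \<noteq> j' \<and> quo (s i) (s j) = quo (f i') (f j') \<and> max i' j' = max i j"
  shows "\<exists>b<L. \<forall>j. 2 \<le> j \<longrightarrow> j \<le> q \<longrightarrow> s j = p j b"
proof -
  have "\<exists>k b. s i = p k b \<and> k \<le> q \<and> b < L" if "i \<le> q" for i
    using s[OF that] by (auto simp: S_def)
  then obtain \<sigma> \<kappa> where \<sigma>: "s i = p (\<sigma> i) (\<kappa> i)" "\<sigma> i \<le> q" "\<kappa> i < L" if "i \<le> q" for i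
    by metis
  have *: "\<kappa> i = \<kappa> j \<and> \<sigma> i \<noteq> \<sigma> j \<and> max (\<sigma> i) (\<sigma> j) = max i j"
    if ij: "i \<le> q" "j \<le> q" "i \<noteq> j" for i j
  proof -
    obtain i' j' where 1: "i' \<le> q" "j' \<le> q" "i' \<noteq> j'" "quo (s i) (s j) = quo (f i') (f j')"
      "max i' j' = max i j" using level[OF ij] by blast
    have k: "\<kappa> i = \<kappa> j"
      using same_block[of "\<kappa> i" "\<kappa> j" "\<sigma> i" "\<sigma> j" i' j'] 1 \<sigma> ij by simp
    then have 2: "quo (f (\<sigma> i)) (f (\<sigma> j)) = quo (f i') (f j')"
      using 1 \<sigma> ij quo_p_same by metis
    have "\<sigma> i \<noteq> \<sigma> j"
      using 1 2 f_closed \<sigma> ij f_inj by (metis quo_eq_one_iff)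
    then show ?thesis using k 1 2 level_unique[of "\<sigma> i" "\<sigma> j" i' j'] \<sigma> ij by simp
  qed
  show ?thesis
  proof (intro exI[of _ "\<kappa> q"] conjI allI impI)
    show "\<kappa> q < L" using \<sigma> by simp
    fix j assume j: "2 \<le> j" "j \<le> q"
    then have "\<sigma> j = j" using max_preserving_fixes[of q \<sigma> j] * by blast
    then show "s j = p j (\<kappa> q)" using \<sigma> * j by (metis order_refl)
  qed
qed

text \<open>The block of index 0 is the only singleton block, so a right translation preserving \<open>S\<close>
  must fix its element.\<close>

lemma right_stabilizer_trivial:
  assumes u: "u \<in> carrier G" and stab: "\<And>s. s \<in> carrier G \<Longrightarrow> s \<otimes> u \<in> S \<longleftrightarrow> s \<in> S"
  shows "u = \<one>"
proof -
  have L: "0 < L" by (simp add: L_eq)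
  have "p 0 0 \<in> S" using L by (auto simp: S_def)
  then have "p 0 0 \<otimes> u \<in> S" using stab L by simp
  then obtain i k where ik: "p 0 0 \<otimes> u = p i k" "i \<le> q" "i \<le> k" "k < L" by (auto simp: S_def)
  have "k = 0"
  proof (rule ccontr)
    assume "k \<noteq> 0"
    \<comment> \<open>Block \<open>k\<close> has a second position \<open>j\<close>. Translating the
      two points back by \<open>inv u\<close> gives \<open>p 0 0\<close> and some
      \<open>p l m\<close> with the same quotient, so \<open>m = 0\<close> by
      \<open>same_block\<close>. As block 0 is a singleton, the quotient is trivial, contrary to
      \<open>j\<close> differing from \<open>i\<close>.\<close>
    define j where "j = (if i = 0 then 1 else (0::nat))"
    have j: "j \<le> q" "j \<le> k" "j \<noteq> i" using q_ge_2 \<open>k \<noteq> 0\<close> by (auto simp: j_def)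
    have "p j k \<in> S" using j ik by (auto simp: S_def)
    then have "p j k \<otimes> inv u \<in> S"
      using stab[of "p j k \<otimes> inv u"] j ik u by (simp add: m_assoc)
    then obtain l m where lm: "p j k \<otimes> inv u = p l m" "l \<le> q" "l \<le> m" "m < L"
      by (auto simp: S_def)
    have "p 0 0 = p i k \<otimes> inv u" using ik u L by (simp add: inv_solve_right)
    then have q: "quo (p 0 0) (p l m) = quo (p i k) (p j k)"
      using quo_mult_right[of "p i k" "p j k" "inv u"] ik j lm u by simp
    then have "m = 0"
      using same_block[of 0 m 0 l i j] ik j lm L quo_p_same by simp
    then have "quo (p i k) (p j k) = \<one>" using lm q L by simp
    then show False using p_inj[of k k i j] ik j by (simp add: quo_eq_one_iff)
  qed
  then show ?thesis using ik u L by simp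
qed

section \<open>Rigidity of pairs of maps preserving incidence\<close>

text \<open>Left translation by \<open>g\<close> matches the two sets. The right-hand side counts
  the common upper bounds of \<open>g\<close> and \<open>h\<close> in the poset, so it is an
  invariant of automorphisms.\<close>

lemma codegree_eq_card:
  assumes "g \<in> carrier G" "h \<in> carrier G"
  shows "codegree (inv g \<otimes> h) = card {w \<in> carrier G. inv g \<otimes> w \<in> S \<and> inv h \<otimes> w \<in> S}"
proof -
  have *: "inv (inv g \<otimes> h) \<otimes> s = inv h \<otimes> (g \<otimes> s)" if "s \<in> carrier G" for s
    using assms that by (simp add: inv_mult_group m_assoc)
  have "bij_betw (\<lambda>s. g \<otimes> s) {s \<in> S. inv (inv g \<otimes> h) \<otimes> s \<in> S}
     {w \<in> carrier G. inv g \<otimes> w \<in> S \<and> inv h \<otimes> w \<in> S}"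
    by (rule bij_betw_byWitness[where f' = "\<lambda>w. inv g \<otimes> w"])
      (use assms S_subset in \<open>auto simp: m_assoc[symmetric] *\<close>)
  then show ?thesis unfolding codegree_def by (rule bij_betw_same_card)
qed

text \<open>The points \<open>v k\<close> are the lower bounds of \<open>w\<close> coming from one
  block, and \<open>v i = g\<close>. Their images lie below \<open>\<beta> w\<close> and have the
  same codegrees, so by \<open>block_recognition\<close> they come from one block \<open>b\<close>,
  with positions from 2 on kept. The fixed point \<open>g\<close> then gives
  \<open>\<beta> w = g \<otimes> p i b\<close>, which determines
  \<open>\<alpha> (v j)\<close>.\<close>

lemma automorphism_fixes_translates:
  assumes \<alpha>: "\<alpha> ` carrier G \<subseteq> carrier G" "inj_on \<alpha> (carrier G)"
    and \<beta>: "bij_betw \<beta> (carrier G) (carrier G)"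
    and inc: "\<And>g w. g \<in> carrier G \<Longrightarrow> w \<in> carrier G \<Longrightarrow> inv (\<alpha> g) \<otimes> \<beta> w \<in> S \<longleftrightarrow> inv g \<otimes> w \<in> S"
    and ij: "2 \<le> i" "i \<le> q" "2 \<le> j" "j \<le> q"
    and g: "g \<in> carrier G" "\<alpha> g = g"
  shows "\<alpha> (g \<otimes> quo (f i) (f j)) = g \<otimes> quo (f i) (f j)"
proof -
  have q: "q < L" by (simp add: L_eq)
  have \<alpha>_closed: "\<alpha> x \<in> carrier G" if "x \<in> carrier G" for x using \<alpha> that by blast
  have \<beta>_closed: "\<beta> x \<in> carrier G" if "x \<in> carrier G" for x using \<beta> that by (auto simp: bij_betw_def)
  have codeg: "codegree (inv (\<alpha> x) \<otimes> \<alpha> y) = codegree (inv x \<otimes> y)"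
    if "x \<in> carrier G" "y \<in> carrier G" for x y
  proof -
    let ?N = "\<lambda>x y. {w \<in> carrier G. inv x \<otimes> w \<in> S \<and> inv y \<otimes> w \<in> S}"
    have surj: "\<beta> ` carrier G = carrier G" using \<beta> by (simp add: bij_betw_def)
    have "\<beta> ` ?N x y = ?N (\<alpha> x) (\<alpha> y)"
    proof (intro equalityI subsetI)
      fix u assume "u \<in> ?N (\<alpha> x) (\<alpha> y)"
      moreover from this obtain w where "w \<in> carrier G" "u = \<beta> w" using surj by blast
      ultimately show "u \<in> \<beta> ` ?N x y" using inc that by blast
    qed (use inc that \<beta>_closed in blast)
    then have "bij_betw \<beta> (?N x y) (?N (\<alpha> x) (\<alpha> y))"
      by (intro bij_betw_subset[OF \<beta>]) auto
    then show ?thesis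
      using codegree_eq_card[OF that] codegree_eq_card[OF \<alpha>_closed \<alpha>_closed, OF that]
      by (simp only: bij_betw_same_card)
  qed
  \<comment> \<open>Block \<open>q\<close> is the first one that contains all positions from 0 to
    \<open>q\<close>.\<close>
  define w where "w = g \<otimes> p i q"
  define v where "v k = g \<otimes> quo (f i) (f k)" for k
  define s where "s k = inv (\<alpha> (v k)) \<otimes> \<beta> w" for k
  have w: "w \<in> carrier G" using g ij q by (simp add: w_def)
  have v: "v k \<in> carrier G" if "k \<le> q" for k using g ij that f_closed by (simp add: v_def)
  have vw: "inv (v k) \<otimes> w = p k q" if "k \<le> q" for k
    using g ij q that f_closed a_closed
    by (simp add: v_def w_def quo_def p_def inv_mult_group m_assoc)
  have vv: "inv (v k) \<otimes> v l = quo (f k) (f l)" if "k \<le> q" "l \<le> q" for k l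
    using g ij that f_closed by (simp add: v_def quo_def inv_mult_group m_assoc)
  have "\<exists>b<L. \<forall>k. 2 \<le> k \<longrightarrow> k \<le> q \<longrightarrow> s k = p k b"
  proof (rule block_recognition[of s])
    show "s k \<in> S" if "k \<le> q" for k
      unfolding s_def using inc v w vw that q by (auto simp: S_def)
    fix k l assume kl: "k \<le> q" "l \<le> q" "k \<noteq> l"
    have eq: "quo (s k) (s l) = inv (\<alpha> (v k)) \<otimes> \<alpha> (v l)"
      unfolding s_def using kl v w \<alpha>_closed \<beta>_closed
      by (simp add: quo_def inv_mult_group m_assoc)
    have "v k \<noteq> v l"
      using vv[of k l] kl f_inj f_closed v by (metis l_inv quo_eq_one_iff)
    then have "\<alpha> (v k) \<noteq> \<alpha> (v l)" using \<alpha>(2) v kl by (auto simp: inj_on_def)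
    then have "quo (s k) (s l) \<noteq> \<one>"
      unfolding eq using \<alpha>_closed v kl by (metis inv_closed inv_equality inv_inv)
    moreover have "codegree (quo (s k) (s l)) = codegree (quo (f k) (f l))"
      unfolding eq using codeg vv v kl by metis
    ultimately show "\<exists>i' j'. i' \<le> q \<and> j' \<le> q \<and> i' \<noteq> j' \<and> quo (s k) (s l) = quo (f i') (f j') \<and>
        max i' j' = max k l"
      using codegree_determines_level[OF kl] kl v \<alpha>_closed eq by simp
  qed
  then obtain b where b: "b < L" "\<And>k. 2 \<le> k \<Longrightarrow> k \<le> q \<Longrightarrow> s k = p k b" by blast
  have "v i = g" using g ij f_closed by (simp add: v_def)
  then have "inv g \<otimes> \<beta> w = p i b" using b(2)[of i] ij g by (simp add: s_def)
  then have \<beta>w: "\<beta> w = g \<otimes> p i b" using g w \<beta>_closed b ij by (simp add: inv_solve_left')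
  have "inv (\<alpha> (v j)) \<otimes> \<beta> w = p j b" using b(2)[of j] ij by (simp add: s_def)
  then have "\<beta> w = \<alpha> (v j) \<otimes> p j b" using v[of j] \<alpha>_closed w \<beta>_closed b ij by (simp add: inv_solve_left')
  then have "\<alpha> (v j) = quo (g \<otimes> p i b) (p j b)"
    unfolding quo_def using v[of j] \<alpha>_closed \<beta>w b ij g by (subst inv_solve_right) auto
  also have "\<dots> = g \<otimes> quo (p i b) (p j b)"
    unfolding quo_def using b ij g by (simp add: m_assoc)
  also have "\<dots> = v j" unfolding v_def using b ij by (simp add: quo_p_same)
  finally show ?thesis by (simp add: v_def)
qed

text \<open>Fixed points of \<open>\<alpha>\<close> are closed under right multiplication by the
  generators, so they spread from \<open>\<one>\<close> to the whole group. Then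
  \<open>\<beta>\<close> is controlled by the right stabilizer of \<open>S\<close>.\<close>

lemma automorphism_trivial:
  assumes \<alpha>: "\<alpha> ` carrier G \<subseteq> carrier G" "inj_on \<alpha> (carrier G)"
    and \<beta>: "bij_betw \<beta> (carrier G) (carrier G)"
    and inc: "\<And>g w. g \<in> carrier G \<Longrightarrow> w \<in> carrier G \<Longrightarrow> inv (\<alpha> g) \<otimes> \<beta> w \<in> S \<longleftrightarrow> inv g \<otimes> w \<in> S"
    and one: "\<alpha> \<one> = \<one>"
    and gen: "generate G {quo (f i) (f j) |i j. 2 \<le> i \<and> i \<le> q \<and> 2 \<le> j \<and> j \<le> q} = carrier G"
    and x: "x \<in> carrier G"
  shows "\<alpha> x = x" "\<beta> x = x"
proof -
  let ?Q = "{quo (f i) (f j) |i j. 2 \<le> i \<and> i \<le> q \<and> 2 \<le> j \<and> j \<le> q}"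
  \<comment> \<open>Keeping the fixed point \<open>g\<close> arbitrary lets a product be treated one
    factor at a time; inverses of generators are generators again.\<close>
  have translate: "\<alpha> (g \<otimes> y) = g \<otimes> y" if "y \<in> generate G ?Q" "g \<in> carrier G" "\<alpha> g = g" for y g
    using that
  proof (induction arbitrary: g rule: generate.induct)
    case (incl h)
    then show ?case using automorphism_fixes_translates[OF \<alpha> \<beta> inc] by blast
  next
    case (inv h)
    then obtain i j where "h = quo (f i) (f j)" "2 \<le> i" "i \<le> q" "2 \<le> j" "j \<le> q" by blast
    moreover from this have "inv h = quo (f j) (f i)" by (simp add: inv_quo f_closed)
    ultimately show ?case using automorphism_fixes_translates[OF \<alpha> \<beta> inc] inv by simp
  next
    case (eng h h')
    then have "h \<in> carrier G" "h' \<in> carrier G" using gen by auto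
    then show ?case using eng by (simp add: m_assoc[symmetric])
  qed simp
  have \<alpha>_id: "\<alpha> y = y" if "y \<in> carrier G" for y
    using translate[of y \<one>] that gen one by simp
  then show "\<alpha> x = x" using x by simp
  have \<beta>x: "\<beta> x \<in> carrier G" using \<beta> x by (auto simp: bij_betw_def)
  \<comment> \<open>Since \<open>\<alpha>\<close> is the identity, \<open>inc\<close> for the point
    \<open>x \<otimes> inv s\<close> says that right multiplication by
    \<open>inv x \<otimes> \<beta> x\<close> preserves membership in \<open>S\<close>.\<close>
  have "inv x \<otimes> \<beta> x = \<one>"
  proof (rule right_stabilizer_trivial)
    fix s assume s: "s \<in> carrier G"
    then have "inv (\<alpha> (x \<otimes> inv s)) \<otimes> \<beta> x \<in> S \<longleftrightarrow> inv (x \<otimes> inv s) \<otimes> x \<in> S"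
      using x by (intro inc) auto
    then show "s \<otimes> (inv x \<otimes> \<beta> x) \<in> S \<longleftrightarrow> s \<in> S"
      using s x \<beta>x \<alpha>_id by (simp add: inv_mult_group m_assoc)
  qed (use x \<beta>x in auto)
  then show "\<beta> x = x" using x \<beta>x by (metis inv_equality inv_inv inv_closed)
qed

end

section \<open>From poset automorphisms to pairs of maps\<close>

context block_system
begin

lemma mem_l_coset_iff:
  assumes "g \<in> carrier G" "h \<in> carrier G"
  shows "h \<in> g <# S \<longleftrightarrow> inv g \<otimes> h \<in> S"
proof
  assume "h \<in> g <# S"
  then obtain s where "s \<in> S" "h = g \<otimes> s" by (auto simp: l_coset_def)
  then show "inv g \<otimes> h \<in> S" using assms S_subset by auto
next
  assume "inv g \<otimes> h \<in> S"
  moreover have "h = g \<otimes> (inv g \<otimes> h)" using assms by simp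
  ultimately show "h \<in> g <# S" unfolding l_coset_def by blast
qed

text \<open>An automorphism splits into a map on each copy. Dividing by the left translation by
  \<open>t\<close>, the image of \<open>\<one>\<close>, makes it fix \<open>\<one>\<close>, and
  \<open>automorphism_trivial\<close> applies.\<close>

lemma cayley_representation_S:
  assumes gen: "generate G {quo (f i) (f j) |i j. 2 \<le> i \<and> i \<le> q \<and> 2 \<le> j \<and> j \<le> q} = carrier G"
  shows "cayley_representation G S"
  unfolding cayley_representation_def
proof
  let ?V = "carrier G <+> carrier G"
  fix \<phi> assume "\<phi> \<in> carrier (PosetAutoGroup (cayley_poset G S))"
  then have \<phi>: "\<phi> \<in> poset_auto (cayley_poset G S)" by (simp add: PosetAutoGroup_def)
  then have ext: "\<phi> \<in> extensional ?V" and bij: "bij_betw \<phi> ?V ?V"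
    by (auto simp: poset_auto_def Bij_def cayley_poset_def)
  have inj: "x = y" if "x \<in> ?V" "y \<in> ?V" "\<phi> x = \<phi> y" for x y
    using bij that by (auto simp: bij_betw_def inj_on_def)
  have le: "le (cayley_poset G S) (\<phi> x) (\<phi> y) \<longleftrightarrow> le (cayley_poset G S) x y" if "x \<in> ?V" "y \<in> ?V" for x y
    using \<phi> that by (auto simp: poset_auto_def cayley_poset_def)
  obtain s where s: "s \<in> S" "s \<in> carrier G"
    using p_in_S[of 0 0] S_subset by (auto simp: L_eq)
  \<comment> \<open>Each point of the first copy is strictly below one of the second. Strict
    relations only go from the first copy to the second, so both copies are preserved.\<close>
  have step: "\<exists>g' h'. \<phi> (Inl g) = Inl g' \<and> \<phi> (Inr (g \<otimes> s)) = Inr h'" if g: "g \<in> carrier G" for g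
  proof -
    have "le (cayley_poset G S) (Inl g) (Inr (g \<otimes> s))"
      using s by (auto simp: cayley_poset_def l_coset_def)
    then have "le (cayley_poset G S) (\<phi> (Inl g)) (\<phi> (Inr (g \<otimes> s)))"
      using le[of "Inl g" "Inr (g \<otimes> s)"] g s by auto
    moreover have "\<phi> (Inl g) \<noteq> \<phi> (Inr (g \<otimes> s))"
      using inj[of "Inl g" "Inr (g \<otimes> s)"] g s by auto
    ultimately show ?thesis by (auto simp: cayley_poset_def)
  qed
  have "\<exists>g'. \<phi> (Inl g) = Inl g' \<and> g' \<in> carrier G" if g: "g \<in> carrier G" for g
  proof -
    obtain g' where "\<phi> (Inl g) = Inl g'" using step[OF g] by blast
    moreover have "\<phi> (Inl g) \<in> ?V" using bij g by (auto simp: bij_betw_def)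
    ultimately show ?thesis by auto
  qed
  then obtain \<alpha> where \<alpha>: "\<phi> (Inl g) = Inl (\<alpha> g)" "\<alpha> g \<in> carrier G" if "g \<in> carrier G" for g
    by metis
  have "\<exists>h'. \<phi> (Inr h) = Inr h' \<and> h' \<in> carrier G" if h: "h \<in> carrier G" for h
  proof -
    have "h = (h \<otimes> inv s) \<otimes> s" using h s by (simp add: m_assoc)
    then obtain h' where "\<phi> (Inr h) = Inr h'" using step[of "h \<otimes> inv s"] h s by auto
    moreover have "\<phi> (Inr h) \<in> ?V" using bij h by (auto simp: bij_betw_def)
    ultimately show ?thesis by auto
  qed
  then obtain \<beta> where \<beta>: "\<phi> (Inr g) = Inr (\<beta> g)" "\<beta> g \<in> carrier G" if "g \<in> carrier G" for g
    by metis
  have inc: "inv (\<alpha> g) \<otimes> \<beta> h \<in> S \<longleftrightarrow> inv g \<otimes> h \<in> S" if "g \<in> carrier G" "h \<in> carrier G" for g h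
  proof -
    have "le (cayley_poset G S) (\<phi> (Inl g)) (\<phi> (Inr h)) \<longleftrightarrow> le (cayley_poset G S) (Inl g) (Inr h)"
      using le that by blast
    then show ?thesis using that \<alpha> \<beta> by (simp add: cayley_poset_def mem_l_coset_iff)
  qed
  define t where "t = \<alpha> \<one>"
  have t: "t \<in> carrier G" using \<alpha> by (simp add: t_def)
  define \<alpha>' where "\<alpha>' g = inv t \<otimes> \<alpha> g" for g
  define \<beta>' where "\<beta>' g = inv t \<otimes> \<beta> g" for g
  have \<alpha>'_image: "\<alpha>' ` carrier G \<subseteq> carrier G" using \<alpha> t by (auto simp: \<alpha>'_def)
  have \<alpha>'_one: "\<alpha>' \<one> = \<one>" using t by (simp add: \<alpha>'_def flip: t_def)
  have \<alpha>'_inj: "inj_on \<alpha>' (carrier G)"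
  proof (rule inj_onI)
    fix x y assume *: "x \<in> carrier G" "y \<in> carrier G" "\<alpha>' x = \<alpha>' y"
    then have "\<phi> (Inl x) = \<phi> (Inl y)" using \<alpha> t by (simp add: \<alpha>'_def)
    then show "x = y" using inj[of "Inl x" "Inl y"] * by auto
  qed
  have "inj_on \<beta>' (carrier G)"
  proof (rule inj_onI)
    fix x y assume *: "x \<in> carrier G" "y \<in> carrier G" "\<beta>' x = \<beta>' y"
    then have "\<phi> (Inr x) = \<phi> (Inr y)" using \<beta> t by (simp add: \<beta>'_def)
    then show "x = y" using inj[of "Inr x" "Inr y"] * by auto
  qed
  moreover have "\<beta>' ` carrier G \<subseteq> carrier G" using \<beta> t by (auto simp: \<beta>'_def)
  ultimately have \<beta>'_bij: "bij_betw \<beta>' (carrier G) (carrier G)"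
    using finite_carrier by (simp add: bij_betw_def endo_inj_surj)
  have inc': "inv (\<alpha>' g) \<otimes> \<beta>' h \<in> S \<longleftrightarrow> inv g \<otimes> h \<in> S"
    if "g \<in> carrier G" "h \<in> carrier G" for g h
    using inc[OF that] \<alpha> \<beta> that t by (simp add: \<alpha>'_def \<beta>'_def inv_mult_group m_assoc)
  have "\<alpha>' x = x \<and> \<beta>' x = x" if "x \<in> carrier G" for x
    using automorphism_trivial[OF \<alpha>'_image \<alpha>'_inj \<beta>'_bij inc' \<alpha>'_one gen that] by blast
  then have "\<alpha> x = t \<otimes> x \<and> \<beta> x = t \<otimes> x" if "x \<in> carrier G" for x
    using that t \<alpha> \<beta> unfolding \<alpha>'_def \<beta>'_def by (metis inv_solve_left')
  then have "\<phi> = left_action G t"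
    using \<alpha> \<beta> ext by (intro extensionalityI[of _ ?V]) (auto simp: left_action_def)
  then show "\<phi> \<in> left_action G ` carrier G" using t by blast
qed

end

section \<open>Greedy choice of generic elements\<close>

context group
begin

text \<open>\<open>K\<close> contains the two disjoint right cosets \<open>H\<close> and
  \<open>H y\<close>.\<close>

lemma card_proper_subgroup:
  assumes H: "subgroup H G" and K: "subgroup K G" "finite K" and "H \<subseteq> K" and y: "y \<in> K" "y \<notin> H"
  shows "2 * card H \<le> card K"
proof -
  have HG: "H \<subseteq> carrier G" and yG: "y \<in> carrier G"
    using H K(1) y subgroup.subset by blast+
  have "x \<otimes> y \<notin> H" if "x \<in> H" for x
  proof
    assume "x \<otimes> y \<in> H"
    then have "inv x \<otimes> (x \<otimes> y) \<in> H"
      using H that by (simp add: subgroup.m_closed subgroup.m_inv_closed)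
    then show False using y(2) that HG yG by (simp add: subset_iff)
  qed
  then have "H \<inter> (\<lambda>x. x \<otimes> y) ` H = {}" by auto
  moreover have "card ((\<lambda>x. x \<otimes> y) ` H) = card H"
    using HG yG by (intro card_image inj_onI) (metis right_cancel subsetD)
  moreover have "finite H" using assms finite_subset by blast
  ultimately have "card (H \<union> (\<lambda>x. x \<otimes> y) ` H) = 2 * card H"
    by (simp add: card_Un_disjoint)
  moreover have "H \<union> (\<lambda>x. x \<otimes> y) ` H \<subseteq> K"
    using assms subgroup.m_closed by fastforce
  ultimately show ?thesis using K(2) by (metis card_mono)
qed

text \<open>Each \<open>f j\<close> avoids at most \<open>q ^ 3\<close> elements that repeat an
  earlier quotient, and a coset of at most half the group that would keep the generated subgroup
  from growing. A subgroup that keeps doubling is everything after about \<open>log |G|\<close>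
  choices.\<close>

lemma ex_generic_generating_sequence:
  assumes fin: "finite (carrier G)" and q: "2 \<le> q" and small: "card (carrier G) < 2 ^ (q - 2)"
    and large: "2 * q ^ 3 < card (carrier G)"
  shows "\<exists>f. (\<forall>i. f i \<in> carrier G) \<and>
    (\<forall>j\<le>q. \<forall>i<j. \<forall>k<j. \<forall>l<j. quo (f j) (f i) \<noteq> quo (f k) (f l)) \<and>
    generate G {quo (f i) (f j) |i j. 2 \<le> i \<and> i \<le> q \<and> 2 \<le> j \<and> j \<le> q} = carrier G"
proof -
  \<comment> \<open>The strict bounds make \<open>Q f j\<close> depend only on values chosen before
    \<open>f j\<close>; the final set of generators is \<open>Q f (Suc q)\<close>.\<close>
  define Q where "Q f j = {quo (f k) (f l) |k l. 2 \<le> k \<and> k < j \<and> 2 \<le> l \<and> l < j}" for f :: "nat \<Rightarrow> 'a" and j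
  define P where "P f j y \<longleftrightarrow> y \<in> carrier G \<and> (j \<le> q \<longrightarrow>
    (\<forall>i<j. \<forall>k<j. \<forall>l<j. quo y (f i) \<noteq> quo (f k) (f l)) \<and>
    (2 < j \<and> generate G (Q f j) \<noteq> carrier G \<longrightarrow> quo y (f 2) \<notin> generate G (Q f j)))" for f j y
  have "\<exists>f. \<forall>j. P f j (f j)"
  proof (rule dependent_wellorder_choice)
    fix y and f g :: "nat \<Rightarrow> 'a" and j :: nat
    assume eq: "f i = g i" if "i < j" for i
    have "Q f j = Q g j" using eq unfolding Q_def by (intro Collect_cong) metis
    moreover have "2 < j \<Longrightarrow> f 2 = g 2" using eq by simp
    ultimately show "P f j y = P g j y" unfolding P_def using eq by auto
  next
    fix j and f :: "nat \<Rightarrow> 'a"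
    assume prev: "P f i (f i)" if "i < j" for i
    have f: "f i \<in> carrier G" if "i < j" for i using prev[OF that] by (simp add: P_def)
    let ?H = "generate G (Q f j)"
    have H: "subgroup ?H G"
      by (rule generate_is_subgroup) (use f in \<open>auto simp: Q_def\<close>)
    have HG: "?H \<subseteq> carrier G" using H subgroup.subset by blast
    define B1 where "B1 = (\<lambda>(i, k, l). quo (f k) (f l) \<otimes> f i) ` ({..<j} \<times> {..<j} \<times> {..<j})"
    define B2 where "B2 = (if 2 < j \<and> ?H \<noteq> carrier G then (\<lambda>h. h \<otimes> f 2) ` ?H else {})"
    show "\<exists>y. P f j y"
    proof (cases "j \<le> q")
      case False
      \<comment> \<open>Beyond \<open>q\<close> only membership in the group is required, so
        \<open>\<one>\<close> serves as default value.\<close>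
      then show ?thesis by (auto simp: P_def intro: exI[of _ \<one>])
    next
      case True
      have "card B1 \<le> card ({..<j} \<times> {..<j} \<times> {..<j})"
        unfolding B1_def by (rule card_image_le) simp
      also have "\<dots> = j ^ 3" by (simp add: card_cartesian_product power3_eq_cube)
      also have "\<dots> \<le> q ^ 3" using True by (simp add: power_mono)
      finally have B1: "card B1 \<le> q ^ 3" .
      have B2: "2 * card B2 \<le> card (carrier G)"
      proof (cases "2 < j \<and> ?H \<noteq> carrier G")
        case True
        then obtain y where "y \<in> carrier G" "y \<notin> ?H" using HG by blast
        then have "2 * card ?H \<le> card (carrier G)"
          using card_proper_subgroup[OF H subgroup_self fin HG] by blast
        moreover have "card B2 \<le> card ?H"
          unfolding B2_def using True HG fin finite_subset by (auto intro!: card_image_le)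
        ultimately show ?thesis by linarith
      qed (auto simp: B2_def)
      have "finite (B1 \<union> B2)"
        using HG fin finite_subset by (auto simp: B1_def B2_def)
      moreover have "card (B1 \<union> B2) < card (carrier G)"
        using card_Un_le[of B1 B2] B1 B2 large by linarith
      ultimately obtain y where y: "y \<in> carrier G" "y \<notin> B1" "y \<notin> B2"
        by (meson UnCI card_mono leD subsetI)
      have "quo y (f i) \<noteq> quo (f k) (f l)" if "i < j" "k < j" "l < j" for i k l
      proof
        assume eq: "quo y (f i) = quo (f k) (f l)"
        have "y = quo y (f i) \<otimes> f i" using y f that by (simp add: quo_def m_assoc)
        then have "y \<in> B1" unfolding B1_def eq using that by force
        then show False using y by blast
      qed
      moreover have "quo y (f 2) \<notin> ?H" if "2 < j" "?H \<noteq> carrier G"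
      proof
        assume H': "quo y (f 2) \<in> ?H"
        have "y = quo y (f 2) \<otimes> f 2" using y f that by (simp add: quo_def m_assoc)
        then have "y \<in> B2" unfolding B2_def using that H' by auto
        then show False using y by blast
      qed
      ultimately show ?thesis using y(1) unfolding P_def by blast
    qed
  qed
  then obtain f where f: "P f j (f j)" for j by blast
  have fG: "f i \<in> carrier G" for i using f[of i] by (simp add: P_def)
  have sub: "subgroup (generate G (Q f j)) G" for j
    by (rule generate_is_subgroup) (use fG in \<open>auto simp: Q_def\<close>)
  have subset: "generate G (Q f j) \<subseteq> carrier G" for j using sub subgroup.subset by blast
  \<comment> \<open>At \<open>j = 2\<close> the only generator is \<open>quo (f 2) (f 2)\<close>,
    whence the exponent \<open>j - 2\<close>. Later each \<open>quo (f j) (f 2)\<close> is new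
    unless the group is already exhausted. At \<open>j = q\<close> the hypothesis
    \<open>small\<close> excludes the second alternative.\<close>
  have growth: "j \<le> q \<longrightarrow> generate G (Q f (Suc j)) = carrier G \<or> 2 ^ (j - 2) \<le> card (generate G (Q f (Suc j)))"
    if "2 \<le> j" for j
    using that
  proof (induction j rule: dec_induct)
    case base
    have "card (generate G (Q f (Suc 2))) \<noteq> 0"
      using generate.one[of G] subset fin finite_subset by (metis card_0_eq empty_iff)
    then show ?case by simp
  next
    case (step j)
    show ?case
    proof
      assume "Suc j \<le> q"
      let ?H = "generate G (Q f (Suc j))" and ?K = "generate G (Q f (Suc (Suc j)))"
      have HK: "?H \<subseteq> ?K" by (rule mono_generate) (use less_SucI in \<open>unfold Q_def, blast\<close>)
      show "?K = carrier G \<or> 2 ^ (Suc j - 2) \<le> card ?K"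
      proof (cases "?H = carrier G")
        case True
        then show ?thesis using HK subset[of "Suc (Suc j)"] by auto
      next
        case False
        then have "quo (f (Suc j)) (f 2) \<notin> ?H"
          using f[of "Suc j"] \<open>Suc j \<le> q\<close> step.hyps by (simp add: P_def)
        moreover have "quo (f (Suc j)) (f 2) \<in> ?K"
          using step.hyps by (intro generate.incl) (force simp: Q_def)
        moreover have "finite ?K" using subset fin finite_subset by blast
        ultimately have "2 * card ?H \<le> card ?K"
          using card_proper_subgroup[OF sub sub _ HK] by blast
        moreover have "2 ^ (j - 2) \<le> card ?H" using step.IH False \<open>Suc j \<le> q\<close> by simp
        moreover have "(2::nat) ^ (Suc j - 2) = 2 * 2 ^ (j - 2)"
          using step.hyps by (simp add: Suc_diff_le flip: power_Suc)
        ultimately show ?thesis by linarith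
      qed
    qed
  qed
  have "card (generate G (Q f (Suc q))) \<le> card (carrier G)"
    using subset fin by (intro card_mono)
  then have "generate G (Q f (Suc q)) = carrier G"
    using growth[of q] q small by auto
  then have "generate G {quo (f i) (f j) |i j. 2 \<le> i \<and> i \<le> q \<and> 2 \<le> j \<and> j \<le> q} = carrier G"
    by (simp add: Q_def less_Suc_eq_le)
  then show ?thesis using f fG by (intro exI[of _ f]) (auto simp: P_def)
qed

text \<open>A forbidden equation can be solved for \<open>a k\<close>: its solution is determined by
  a position \<open>i\<close> and three earlier elements of the form
  \<open>f i \<otimes> a l\<close>. There are at most \<open>(q + 1) * L\<close> such elements,
  which gives the bound in \<open>large\<close>.\<close>

lemma ex_generic_translates:
  assumes fin: "finite (carrier G)" and f: "\<And>i. f i \<in> carrier G"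
    and large: "(q + 1) * ((q + 1) * L) ^ 3 < card (carrier G)"
  shows "\<exists>a. \<forall>k. a k \<in> carrier G \<and> (k < L \<longrightarrow>
    (\<forall>l<k. \<forall>m<k. \<forall>n<k. \<forall>i\<le>q. \<forall>j\<le>q. \<forall>i'\<le>q. \<forall>j'\<le>q.
      quo (f i \<otimes> a k) (f j \<otimes> a l) \<noteq> quo (f i' \<otimes> a m) (f j' \<otimes> a n)))"
proof (rule dependent_wellorder_choice)
  fix k and a :: "nat \<Rightarrow> 'a"
  assume prev: "a l \<in> carrier G \<and> (l < L \<longrightarrow>
    (\<forall>l'<l. \<forall>m<l. \<forall>n<l. \<forall>i\<le>q. \<forall>j\<le>q. \<forall>i'\<le>q. \<forall>j'\<le>q.
      quo (f i \<otimes> a l) (f j \<otimes> a l') \<noteq> quo (f i' \<otimes> a m) (f j' \<otimes> a n)))" if "l < k" for l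
  show "\<exists>y. y \<in> carrier G \<and> (k < L \<longrightarrow>
    (\<forall>l<k. \<forall>m<k. \<forall>n<k. \<forall>i\<le>q. \<forall>j\<le>q. \<forall>i'\<le>q. \<forall>j'\<le>q.
      quo (f i \<otimes> y) (f j \<otimes> a l) \<noteq> quo (f i' \<otimes> a m) (f j' \<otimes> a n)))"
  proof (cases "k < L")
    case False
    then show ?thesis by (auto intro: exI[of _ \<one>])
  next
    case True
    have a: "a l \<in> carrier G" if "l < k" for l using prev[OF that] by simp
    define X where "X = (\<lambda>(i, l). f i \<otimes> a l) ` ({..q} \<times> {..<k})"
    have "finite X" by (simp add: X_def)
    have "card X \<le> card ({..q} \<times> {..<k})" unfolding X_def by (rule card_image_le) simp
    also have "\<dots> = (q + 1) * k" by (simp add: card_cartesian_product)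
    also have "\<dots> \<le> (q + 1) * L" using True by (intro mult_left_mono) auto
    finally have X: "card X \<le> (q + 1) * L" .
    define B where "B = (\<lambda>(i, x, y, z). inv (f i) \<otimes> (quo x y \<otimes> z)) ` ({..q} \<times> X \<times> X \<times> X)"
    have "card B \<le> card ({..q} \<times> X \<times> X \<times> X)"
      unfolding B_def using \<open>finite X\<close> by (intro card_image_le) simp
    also have "\<dots> = (q + 1) * card X ^ 3"
      by (simp add: card_cartesian_product power3_eq_cube)
    also have "\<dots> \<le> (q + 1) * ((q + 1) * L) ^ 3"
      using X by (intro mult_left_mono power_mono) auto
    finally have "card B < card (carrier G)" using large by linarith
    moreover have "finite B" using \<open>finite X\<close> by (simp add: B_def)
    ultimately obtain y where y: "y \<in> carrier G" "y \<notin> B"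
      by (meson card_mono leD subsetI)
    have "quo (f i \<otimes> y) (f j \<otimes> a l) \<noteq> quo (f i' \<otimes> a m) (f j' \<otimes> a n)"
      if "l < k" "m < k" "n < k" "i \<le> q" "j \<le> q" "i' \<le> q" "j' \<le> q" for l m n i j i' j'
    proof
      assume eq: "quo (f i \<otimes> y) (f j \<otimes> a l) = quo (f i' \<otimes> a m) (f j' \<otimes> a n)"
      have "f i \<otimes> y = quo (f i \<otimes> y) (f j \<otimes> a l) \<otimes> (f j \<otimes> a l)"
        using y f a that by (simp add: quo_def m_assoc)
      then have y_eq: "y = inv (f i) \<otimes> (quo (f i' \<otimes> a m) (f j' \<otimes> a n) \<otimes> (f j \<otimes> a l))"
        unfolding eq using y f a that by (metis inv_mult_cancel)
      have mem: "(i, f i' \<otimes> a m, f j' \<otimes> a n, f j \<otimes> a l) \<in> {..q} \<times> X \<times> X \<times> X"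
        unfolding X_def using that by auto
      have "y \<in> B" unfolding B_def by (rule image_eqI[OF _ mem]) (simp add: y_eq)
      then show False using y by blast
    qed
    then show ?thesis using y(1) by blast
  qed
qed simp

text \<open>For \<open>L = 4 * (q + 1)\<close> the bound required by
  \<open>ex_generic_translates\<close> is exactly \<open>64 * (q + 1) ^ 7\<close>, and it dominates
  the \<open>2 * q ^ 3\<close> of \<open>ex_generic_generating_sequence\<close>.\<close>

lemma admits_cayley_representation_if_large:
  assumes fin: "finite (carrier G)" and q: "2 \<le> q" and small: "card (carrier G) < 2 ^ (q - 2)"
    and large: "64 * (q + 1) ^ 7 < card (carrier G)"
  shows "admits_cayley_representation G"
proof -
  define L where "L = 4 * q + 4"
  have "r * (r * (4 * r)) ^ 3 = 64 * r ^ 7" for r :: nat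
    by (simp add: power_mult_distrib power_numeral_reduce)
  moreover have "L = 4 * (q + 1)" by (simp add: L_def)
  ultimately have "(q + 1) * ((q + 1) * L) ^ 3 = 64 * (q + 1) ^ 7" by (simp only:)
  with large have large': "(q + 1) * ((q + 1) * L) ^ 3 < card (carrier G)" by simp
  have "2 * q ^ 3 \<le> 64 * (q + 1) ^ 7"
  proof (rule mult_mono)
    have "q ^ 3 \<le> (q + 1) ^ 3" by (rule power_mono) auto
    also have "\<dots> \<le> (q + 1) ^ 7" by (rule power_increasing) auto
    finally show "q ^ 3 \<le> (q + 1) ^ 7" .
  qed auto
  then have "2 * q ^ 3 < card (carrier G)" using large by linarith
  from ex_generic_generating_sequence[OF fin q small this] obtain f where
    f: "\<forall>i. f i \<in> carrier G" "\<forall>j\<le>q. \<forall>i<j. \<forall>k<j. \<forall>l<j. quo (f j) (f i) \<noteq> quo (f k) (f l)"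
    and gen: "generate G {quo (f i) (f j) |i j. 2 \<le> i \<and> i \<le> q \<and> 2 \<le> j \<and> j \<le> q} = carrier G"
    by blast
  from ex_generic_translates[OF fin f(1)[rule_format] large'] obtain a where
    a: "\<forall>k. a k \<in> carrier G \<and> (k < L \<longrightarrow>
      (\<forall>l<k. \<forall>m<k. \<forall>n<k. \<forall>i\<le>q. \<forall>j\<le>q. \<forall>i'\<le>q. \<forall>j'\<le>q.
      quo (f i \<otimes> a k) (f j \<otimes> a l) \<noteq> quo (f i' \<otimes> a m) (f j' \<otimes> a n)))" ..
  interpret block_system G f a q L
  proof unfold_locales
    show "finite (carrier G)" "2 \<le> q" "L = 4 * q + 4" by (fact fin q L_def)+
    show "f i \<in> carrier G" "a i \<in> carrier G" for i using f(1) a by blast+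
    show "quo (f j) (f i) \<noteq> quo (f k) (f l)" if "j \<le> q" "i < j" "k < j" "l < j" for i j k l
      using f(2) that by blast
    show "quo (f i \<otimes> a k) (f j \<otimes> a l) \<noteq> quo (f i' \<otimes> a m) (f j' \<otimes> a n)"
      if "k < L" "l < k" "m < k" "n < k" "i \<le> q" "j \<le> q" "i' \<le> q" "j' \<le> q" for i j k l m n i' j'
      using a that by blast
  qed
  have "S \<noteq> {}" using p_in_S[of 0 0] by (auto simp: L_eq)
  then show ?thesis
    unfolding admits_cayley_representation_def using S_subset cayley_representation_S[OF gen] by blast
qed

end

section \<open>Choice of \<open>q\<close> and finiteness up to isomorphism\<close>

text \<open>If \<open>2 ^ k \<le> n < 2 ^ (k + 1)\<close>, then \<open>q = k + 3\<close> turns the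
  first condition into the upper bound for \<open>n\<close>, and the second follows from
  \<open>64 * (k + 4) ^ 7 < 2 ^ k\<close> for large \<open>k\<close>.\<close>

lemma ex_block_length:
  "\<exists>N. \<forall>n\<ge>N. \<exists>q\<ge>2. n < 2 ^ (q - 2) \<and> 64 * (q + 1) ^ 7 < (n::nat)"
proof -
  have "eventually (\<lambda>k::nat. 64 * (real k + 4) ^ 7 < 2 ^ k) at_top" by real_asymp
  then obtain K where K: "64 * (real k + 4) ^ 7 < 2 ^ k" if "K \<le> k" for k
    by (auto simp: eventually_at_top_linorder)
  show ?thesis
  proof (rule exI[of _ "2 ^ K"], intro allI impI)
    fix n :: nat assume n: "2 ^ K \<le> n"
    then have "1 \<le> n" using one_le_power[of "2::nat" K] by linarith
    then obtain k where k: "2 ^ k \<le> n" "n < 2 ^ (k + 1)" using ex_power_ivl1[of 2 n] by auto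
    with n have "(2::nat) ^ K < 2 ^ (k + 1)" by linarith
    then have "K < k + 1" by (rule power_less_imp_less_exp[rotated]) simp
    then have "K \<le> k" by simp
    have "real (64 * (k + 4) ^ 7) < real (2 ^ k)" using K[OF \<open>K \<le> k\<close>] by simp
    then have "64 * (k + 4) ^ 7 < 2 ^ k" by (simp only: of_nat_less_iff)
    then have "64 * (k + 4) ^ 7 < n" using k(1) by linarith
    moreover have e: "k + 3 + 1 = k + 4" "k + 3 - 2 = k + 1" by simp_all
    ultimately have "2 \<le> k + 3 \<and> n < 2 ^ (k + 3 - 2) \<and> 64 * (k + 3 + 1) ^ 7 < n"
      unfolding e using k(2) by simp
    then show "\<exists>q\<ge>2. n < 2 ^ (q - 2) \<and> 64 * (q + 1) ^ 7 < n" by blast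
  qed
qed

text \<open>The multiplication is transported to \<open>{..<n}\<close> along a bijection, and there
  are only finitely many multiplication tables and units on these sets.\<close>

lemma finite_monoids_bounded_order:
  "\<exists>\<F> :: nat monoid set. finite \<F> \<and>
    (\<forall>G :: ('a, 'm) monoid_scheme. monoid G \<and> finite (carrier G) \<and> card (carrier G) < N \<longrightarrow>
      (\<exists>H \<in> \<F>. G \<cong> H))"
proof (intro exI conjI allI impI)
  \<comment> \<open>Extensional functions are used because values outside the table would otherwise
    yield infinitely many records.\<close>
  let ?I = "SIGMA n:{..<N}. (({..<n} \<times> {..<n}) \<rightarrow>\<^sub>E {..<n}) \<times> {..<n}"
  let ?M = "\<lambda>(n, m, e). \<lparr>carrier = {..<n}, monoid.mult = curry m, one = e\<rparr> :: nat monoid"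
  show "finite (?M ` ?I)" by (intro finite_imageI finite_SigmaI finite_cartesian_product finite_PiE) auto
  fix G :: "('a, 'm) monoid_scheme"
  assume "monoid G \<and> finite (carrier G) \<and> card (carrier G) < N"
  then have G: "monoid G" "finite (carrier G)" "card (carrier G) < N" by auto
  define n where "n = card (carrier G)"
  obtain h where h: "bij_betw h (carrier G) {..<n}"
    using ex_bij_betw_finite_nat[OF G(2)] by (auto simp: n_def atLeast0LessThan)
  define h' where "h' = inv_into (carrier G) h"
  have h_less: "h x < n" if "x \<in> carrier G" for x
    using h that by (auto simp: bij_betw_def)
  have h'_closed: "h' i \<in> carrier G" if "i < n" for i
    using h that by (auto simp: bij_betw_def h'_def inv_into_into)
  have h'_h: "h' (h x) = x" if "x \<in> carrier G" for x
    using h that by (simp add: bij_betw_def h'_def)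
  define m where "m = (\<lambda>(i, j) \<in> {..<n} \<times> {..<n}. h (h' i \<otimes>\<^bsub>G\<^esub> h' j))"
  have "m \<in> ({..<n} \<times> {..<n}) \<rightarrow>\<^sub>E {..<n}"
    using G(1) by (auto simp: m_def intro!: h_less monoid.m_closed h'_closed)
  then have "(n, m, h \<one>\<^bsub>G\<^esub>) \<in> ?I"
    using G h_less monoid.one_closed by (auto simp: n_def)
  moreover have "h \<in> iso G (?M (n, m, h \<one>\<^bsub>G\<^esub>))"
    using h h_less h'_h by (auto simp: iso_def hom_def m_def)
  ultimately show "\<exists>H \<in> ?M ` ?I. G \<cong> H" using is_isoI by blast
qed

theorem corollary13:
  shows "\<exists>\<F> :: nat monoid set. finite \<F> \<and>
    (\<forall>G :: ('a, 'm) monoid_scheme.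
       simple_group G \<and> finite (carrier G) \<and> \<not> admits_cayley_representation G \<longrightarrow>
       (\<exists>H \<in> \<F>. G \<cong> H))"
proof -
  obtain N where N: "\<exists>q\<ge>2. n < 2 ^ (q - 2) \<and> 64 * (q + 1) ^ 7 < n" if "N \<le> n" for n :: nat
    using ex_block_length by blast
  have bounded: "monoid G \<and> card (carrier G) < N"
    if "simple_group G" "finite (carrier G)" "\<not> admits_cayley_representation G"
    for G :: "('a, 'm) monoid_scheme"
  proof -
    interpret simple_group G by fact
    show ?thesis
      using N[of "card (carrier G)"] admits_cayley_representation_if_large that monoid_axioms
      by (meson not_le)
  qed
  obtain \<F> :: "nat monoid set" where "finite \<F>"
    "\<forall>G :: ('a, 'm) monoid_scheme. monoid G \<and> finite (carrier G) \<and> card (carrier G) < N \<longrightarrow>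
      (\<exists>H \<in> \<F>. G \<cong> H)"
    using finite_monoids_bounded_order by blast
  then show ?thesis using bounded by blast
qed

end
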